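(* There are instances $(X, k)$ of the $k$-means problem which are $\gamma$-distributed, but are not $(1 + \Omega(\gamma))$-weakly deletion stable, for some parameter $\gamma > 0$.
   Context: $OPT^{\star}$ denotes the optimal $k$-means cost of $X$, i.e. the minimum over $k$-center sets $C$ of $\sum_{x\in X}\min_{c\in C}\|x-c\|^2$, and $\mu(Y)$ the centroid of $Y$. An instance $(X,k)$ is $\gamma$-distributed iff for every optimal clustering $\{X_1^{\star},\ldots,X_k^{\star}\}$, for all $i$ and all $x \notin X_i^{\star}$, $\|x - \mu(X_i^{\star})\|^2 \geq \gamma\cdot\frac{OPT^{\star}}{|X_i^{\star}|}$. Let $c_1^{\star},\ldots,c_k^{\star}$ be an optimal set of $k$ centers (each point assigned to its closest center). The instance is $(1+\gamma)$-weakly deletion stable if for all $i \neq j$, $OPT^{(i\to j)} > (1+\gamma)\,OPT^{\star}$, where $OPT^{(i\to j)}$ is the cost of the clustering obtained by removing $c_i^{\star}$ as a center and assigning all points assigned to it to $c_j^{\star}$. *)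

theory Defs
  imports
    Complex_Main
    "HOL-Library.Disjoint_Sets"
    "Jordan_Normal_Form.Matrix"
begin

(* Points of R^d are vectors in carrier_vec d, because the dimension is part of the
   instance and is quantified over. *)

definition sqdist :: "real vec \<Rightarrow> real vec \<Rightarrow> real" where
  "sqdist x y = (x - y) \<bullet> (x - y)"

definition centroid :: "nat \<Rightarrow> real vec set \<Rightarrow> real vec" where
  "centroid d Y = vec d (\<lambda>i. (\<Sum>x\<in>Y. x $ i) / real (card Y))"

definition kmeans_instance :: "nat \<Rightarrow> real vec set \<Rightarrow> nat \<Rightarrow> bool" where
  "kmeans_instance d X k \<longleftrightarrow>
     finite X \<and> X \<subseteq> carrier_vec d \<and> 1 \<le> k \<and> k \<le> card X"

definition center_set :: "nat \<Rightarrow> nat \<Rightarrow> real vec set \<Rightarrow> bool" where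
  "center_set d k C \<longleftrightarrow> finite C \<and> C \<subseteq> carrier_vec d \<and> card C = k"

definition center_cost :: "real vec set \<Rightarrow> real vec set \<Rightarrow> real" where
  "center_cost X C = (\<Sum>x\<in>X. Min (sqdist x ` C))"

(* The infimum is attained for every k-means instance. *)
definition opt_cost :: "nat \<Rightarrow> real vec set \<Rightarrow> nat \<Rightarrow> real" where
  "opt_cost d X k = (INF C\<in>{C. center_set d k C}. center_cost X C)"

definition clustering_cost :: "nat \<Rightarrow> real vec set set \<Rightarrow> real" where
  "clustering_cost d P = (\<Sum>Y\<in>P. \<Sum>x\<in>Y. sqdist x (centroid d Y))"

(* Since k <= card X and the points of X are distinct, an optimal solution has no empty
   cluster, so requiring the parts to be nonempty excludes nothing. *)
definition optimal_clustering ::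
  "nat \<Rightarrow> real vec set \<Rightarrow> nat \<Rightarrow> real vec set set \<Rightarrow> bool" where
  "optimal_clustering d X k P \<longleftrightarrow>
     partition_on X P \<and> card P = k \<and> clustering_cost d P = opt_cost d X k"

definition distributed :: "real \<Rightarrow> nat \<Rightarrow> real vec set \<Rightarrow> nat \<Rightarrow> bool" where
  "distributed \<gamma> d X k \<longleftrightarrow>
     (\<forall>P. optimal_clustering d X k P \<longrightarrow>
       (\<forall>Y\<in>P. \<forall>x\<in>X - Y.
          sqdist x (centroid d Y) \<ge> \<gamma> * (opt_cost d X k / real (card Y))))"

definition optimal_centers ::
  "nat \<Rightarrow> real vec set \<Rightarrow> nat \<Rightarrow> real vec set \<Rightarrow> bool" where
  "optimal_centers d X k C \<longleftrightarrow>
     center_set d k C \<and> center_cost X C = opt_cost d X k"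

(* Ties between closest centers may be broken arbitrarily. *)
definition closest_assignment ::
  "real vec set \<Rightarrow> real vec set \<Rightarrow> (real vec \<Rightarrow> real vec) \<Rightarrow> bool" where
  "closest_assignment X C a \<longleftrightarrow>
     (\<forall>x\<in>X. is_arg_min (sqdist x) (\<lambda>c. c \<in> C) (a x))"

definition deletion_cost ::
  "real vec set \<Rightarrow> (real vec \<Rightarrow> real vec) \<Rightarrow> real vec \<Rightarrow> real vec \<Rightarrow> real" where
  "deletion_cost X a c c' = (\<Sum>x\<in>X. sqdist x (if a x = c then c' else a x))"

(* The parameter \<beta> is the whole factor, i.e. 1 + \<gamma> in "(1 + \<gamma>)-weakly deletion stable". *)
definition weakly_deletion_stable :: "real \<Rightarrow> nat \<Rightarrow> real vec set \<Rightarrow> nat \<Rightarrow> bool" where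
  "weakly_deletion_stable \<beta> d X k \<longleftrightarrow>
     (\<forall>C a. optimal_centers d X k C \<longrightarrow> closest_assignment X C a \<longrightarrow>
       (\<forall>c\<in>C. \<forall>c'\<in>C. c \<noteq> c' \<longrightarrow> deletion_cost X a c c' > \<beta> * opt_cost d X k))"

end

theory Submission
  imports Defs
begin

text \<open>
  Take the \<open>2m\<close> vertices of a regular simplex and shift half of them by a small \<open>\<delta>\<close> in an extra
  orthogonal direction. A cluster \<open>Y\<close> of simplex vertices costs \<open>|Y| - 1\<close>, so every split into two
  clusters has the same cost \<open>2m - 2\<close>, and the shift makes the balanced split \<open>A\<close>, \<open>B\<close> the unique
  optimum. A point outside \<open>A\<close> has squared distance more than \<open>1\<close> from the centroid of \<open>A\<close>, whereas
  the average optimal cost \<open>OPT / |A|\<close> is less than \<open>2\<close>, so the instance is \<open>1/2\<close>-distributed.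
  But merging the two clusters raises the cost only from \<open>2m - 2\<close> to about \<open>2m\<close>.
\<close>

section \<open>Squared distances and centroids\<close>

lemma sqdist_sum:
  assumes "x \<in> carrier_vec d" "y \<in> carrier_vec d"
  shows "sqdist x y = (\<Sum>i<d. (x $ i - y $ i)\<^sup>2)"
  using assms
  by (auto simp: sqdist_def scalar_prod_def power2_eq_square lessThan_atLeast0 intro!: sum.cong)

lemma sqdist_commute:
  assumes "x \<in> carrier_vec d" "y \<in> carrier_vec d"
  shows "sqdist x y = sqdist y x"
  using assms by (simp add: sqdist_sum power2_commute)

lemma sqdist_nonneg:
  assumes "x \<in> carrier_vec d" "y \<in> carrier_vec d"
  shows "0 \<le> sqdist x y"
  using assms by (simp add: sqdist_sum sum_nonneg)

lemma centroid_carrier [simp]: "centroid d Y \<in> carrier_vec d"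
  by (simp add: centroid_def)

text \<open>Writing \<open>c - f y\<close> as \<open>(c - s) + (s - f y)\<close>, the cross terms
  cancel because the deviations from the mean \<open>s\<close> sum to zero.\<close>

lemma sum_square_diff_mean:
  fixes f :: "'a \<Rightarrow> real"
  assumes "finite Y" "Y \<noteq> {}"
  defines "s \<equiv> (\<Sum>y\<in>Y. f y) / real (card Y)"
  shows "(\<Sum>y\<in>Y. (c - f y)\<^sup>2) = real (card Y) * (c - s)\<^sup>2 + (\<Sum>y\<in>Y. (f y - s)\<^sup>2)"
proof -
  have "(\<Sum>y\<in>Y. f y) = real (card Y) * s"
    using assms by simp
  then have "(\<Sum>y\<in>Y. s - f y) = 0"
    by (simp add: sum_subtractf)
  moreover have "(c - f y)\<^sup>2 = (c - s)\<^sup>2 + (f y - s)\<^sup>2 + 2 * (c - s) * (s - f y)" for y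
    by (simp add: power2_eq_square algebra_simps)
  ultimately show ?thesis
    by (simp add: sum.distrib flip: sum_distrib_left)
qed

text \<open>The parallel axis identity, obtained from the one-dimensional case in each coordinate.
  It later turns known distances to the points of a cluster into distances to its centroid.\<close>

lemma sum_sqdist_centroid:
  assumes "finite Y" "Y \<noteq> {}" "Y \<subseteq> carrier_vec d" "c \<in> carrier_vec d"
  shows "(\<Sum>y\<in>Y. sqdist c y) =
           real (card Y) * sqdist c (centroid d Y) + (\<Sum>y\<in>Y. sqdist y (centroid d Y))"
proof -
  let ?s = "\<lambda>i. (\<Sum>y\<in>Y. y $ i) / real (card Y)"
  have dist: "sqdist x (centroid d Y) = (\<Sum>i<d. (x $ i - ?s i)\<^sup>2)" if "x \<in> carrier_vec d" for x
    using that by (simp add: sqdist_sum centroid_def)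
  have "(\<Sum>y\<in>Y. sqdist c y) = (\<Sum>y\<in>Y. \<Sum>i<d. (c $ i - y $ i)\<^sup>2)"
    using assms by (intro sum.cong sqdist_sum) auto
  also have "\<dots> = (\<Sum>i<d. \<Sum>y\<in>Y. (c $ i - y $ i)\<^sup>2)"
    by (rule sum.swap)
  also have "\<dots> = (\<Sum>i<d. real (card Y) * (c $ i - ?s i)\<^sup>2 + (\<Sum>y\<in>Y. (y $ i - ?s i)\<^sup>2))"
    using assms(1,2) by (intro sum.cong sum_square_diff_mean) auto
  also have "\<dots> = real (card Y) * (\<Sum>i<d. (c $ i - ?s i)\<^sup>2) + (\<Sum>i<d. \<Sum>y\<in>Y. (y $ i - ?s i)\<^sup>2)"
    by (simp add: sum.distrib sum_distrib_left)
  also have "(\<Sum>i<d. \<Sum>y\<in>Y. (y $ i - ?s i)\<^sup>2) = (\<Sum>y\<in>Y. \<Sum>i<d. (y $ i - ?s i)\<^sup>2)"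
    by (rule sum.swap)
  also have "\<dots> = (\<Sum>y\<in>Y. sqdist y (centroid d Y))"
    using assms dist by (intro sum.cong) auto
  finally show ?thesis
    using assms dist by simp
qed

lemma sum_sqdist_centroid_le:
  assumes "finite Y" "Y \<noteq> {}" "Y \<subseteq> carrier_vec d" "c \<in> carrier_vec d"
  shows "(\<Sum>y\<in>Y. sqdist y (centroid d Y)) \<le> (\<Sum>y\<in>Y. sqdist y c)"
proof -
  have "(\<Sum>y\<in>Y. sqdist y c) = (\<Sum>y\<in>Y. sqdist c y)"
    using assms by (intro sum.cong sqdist_commute) auto
  then show ?thesis
    using sum_sqdist_centroid[OF assms] sqdist_nonneg[OF assms(4) centroid_carrier] by simp
qed

text \<open>Summing the parallel axis identity over \<open>c\<close> in \<open>Y\<close> expresses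
  the cost of a cluster by its pairwise distances alone, so no coordinates are needed to evaluate
  it.\<close>

lemma sum_sqdist_pairs:
  assumes "finite Y" "Y \<noteq> {}" "Y \<subseteq> carrier_vec d"
  shows "(\<Sum>x\<in>Y. \<Sum>y\<in>Y. sqdist x y) =
           2 * real (card Y) * (\<Sum>y\<in>Y. sqdist y (centroid d Y))"
proof -
  have "(\<Sum>x\<in>Y. \<Sum>y\<in>Y. sqdist x y) =
      (\<Sum>x\<in>Y. real (card Y) * sqdist x (centroid d Y) + (\<Sum>y\<in>Y. sqdist y (centroid d Y)))"
    using assms by (intro sum.cong sum_sqdist_centroid) auto
  then show ?thesis
    by (simp add: sum.distrib flip: sum_distrib_left)
qed

section \<open>The shifted simplex, given by its pairwise distances\<close>

locale shifted_simplex =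
  fixes d m :: nat and \<eta> :: real and A B :: "real vec set"
  assumes m: "2 \<le> m"
    and eta: "0 < \<eta>"
    and finA: "finite A" and finB: "finite B"
    and carrier: "A \<union> B \<subseteq> carrier_vec d"
    and cardA: "card A = m" and cardB: "card B = m"
    and disj: "A \<inter> B = {}"
    and dist: "\<And>x y. x \<in> A \<union> B \<Longrightarrow> y \<in> A \<union> B \<Longrightarrow>
      sqdist x y = (if x = y then 0 else if x \<in> A \<longleftrightarrow> y \<in> A then 2 else 2 + \<eta>)"
begin

text \<open>The assumptions are symmetric in the two halves, so every fact about the centroid of
  \<open>A\<close> transfers to that of \<open>B\<close>.\<close>

lemma swap: "shifted_simplex d m \<eta> B A"
proof
  show "sqdist x y = (if x = y then 0 else if x \<in> B \<longleftrightarrow> y \<in> B then 2 else 2 + \<eta>)"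
    if "x \<in> B \<union> A" "y \<in> B \<union> A" for x y
    using that dist[of x y] disj by auto
qed (use m eta finA finB carrier cardA cardB disj in auto)

text \<open>Among the ordered pairs from \<open>Y\<close>, distinct points contribute 2 each and
  pairs across the two halves a further \<open>\<eta>\<close>; dividing by \<open>2 * card Y\<close>
  gives the cost. The last term is the penalty for mixing the halves.\<close>

lemma cluster_cost:
  assumes Y: "Y \<subseteq> A \<union> B" "Y \<noteq> {}"
  shows "(\<Sum>y\<in>Y. sqdist y (centroid d Y)) =
    real (card Y) - 1 + \<eta> * (real (card (Y \<inter> A)) * real (card (Y \<inter> B))) / real (card Y)"
proof -
  have fin: "finite Y"
    using Y finA finB by (meson finite_UnI finite_subset)
  define p q n where "p = real (card (Y \<inter> A))" "q = real (card (Y \<inter> B))" "n = real (card Y)"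
  have n: "n > 0"
    using Y fin by (simp add: p_q_n_def card_gt_0_iff)
  \<comment> \<open>Written with indicator products, the double sum factors into products of
    cardinalities.\<close>
  have d: "sqdist x y = 2 - (if x = y then 2 else 0)
      + \<eta> * ((if x \<in> A then 1 else 0) * (if y \<in> B then 1 else 0)
           + (if x \<in> B then 1 else 0) * (if y \<in> A then 1 else 0))" if "x \<in> Y" "y \<in> Y" for x y
    using that Y dist[of x y] disj by auto
  have count: "(\<Sum>x\<in>Y. (if x \<in> S then 1 else 0)) = real (card (Y \<inter> S))" for S
    using fin by (simp add: sum.If_cases Int_def)
  have "(\<Sum>x\<in>Y. \<Sum>y\<in>Y. sqdist x y) = (\<Sum>x\<in>Y. \<Sum>y\<in>Y. 2 - (if x = y then 2 else 0)
      + \<eta> * ((if x \<in> A then 1 else 0) * (if y \<in> B then 1 else 0)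
           + (if x \<in> B then 1 else 0) * (if y \<in> A then 1 else 0)))"
    using d by (intro sum.cong refl) auto
  also have "\<dots> = 2 * n * n - 2 * n + \<eta> * (p * q + q * p)"
    unfolding p_q_n_def count[symmetric] using fin
    by (simp add: sum.distrib sum_subtractf count algebra_simps flip: sum_distrib_left sum_distrib_right)
  finally have "2 * n * (\<Sum>y\<in>Y. sqdist y (centroid d Y)) = 2 * n * n - 2 * n + \<eta> * (p * q + q * p)"
    using sum_sqdist_pairs[of Y d] fin Y carrier by (auto simp: p_q_n_def)
  then show ?thesis
    using n unfolding p_q_n_def[symmetric] by (simp add: field_simps)
qed

lemma cluster_cost_ge:
  assumes Y: "Y \<subseteq> A \<union> B" and c: "c \<in> carrier_vec d"
  shows "real (card Y) - 1 \<le> (\<Sum>y\<in>Y. sqdist y c)"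
proof (cases "Y = {}")
  case False
  have "finite Y"
    using Y finA finB by (meson finite_UnI finite_subset)
  then have "(\<Sum>y\<in>Y. sqdist y (centroid d Y)) \<le> (\<Sum>y\<in>Y. sqdist y c)"
    using False Y carrier c by (intro sum_sqdist_centroid_le) auto
  moreover have "real (card Y) - 1 \<le> (\<Sum>y\<in>Y. sqdist y (centroid d Y))"
    using cluster_cost[OF Y False] eta by simp
  ultimately show ?thesis by linarith
qed simp

lemma A_nonempty: "A \<noteq> {}"
  using cardA m by auto

lemma cost_A: "(\<Sum>y\<in>A. sqdist y (centroid d A)) = real m - 1"
  using cluster_cost[of A] A_nonempty disj cardA by auto

lemma dist_centroid_same:
  assumes "x \<in> A"
  shows "sqdist x (centroid d A) = (real m - 1) / real m"
proof -
  have "(\<Sum>y\<in>A. sqdist x y) = (\<Sum>y\<in>A. 2 - (if x = y then 2 else 0))"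
    using assms dist[of x] by (intro sum.cong) auto
  also have "\<dots> = 2 * real m - 2"
    using assms finA cardA by (simp add: sum_subtractf)
  finally have "real m * sqdist x (centroid d A) = real m - 1"
    using sum_sqdist_centroid[of A d x] assms carrier finA A_nonempty cost_A cardA by auto
  then show ?thesis
    using m by (simp add: field_simps)
qed

lemma dist_centroid_other:
  assumes "x \<in> B"
  shows "sqdist x (centroid d A) = 1 + 1 / real m + \<eta>"
proof -
  have "(\<Sum>y\<in>A. sqdist x y) = (\<Sum>y\<in>A. 2 + \<eta>)"
    using assms dist[of x] disj by (intro sum.cong) auto
  also have "\<dots> = real m * (2 + \<eta>)"
    using cardA by simp
  finally have "real m * sqdist x (centroid d A) = real m * (2 + \<eta>) - (real m - 1)"
    using sum_sqdist_centroid[of A d x] assms carrier finA A_nonempty cost_A cardA by auto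
  then show ?thesis
    using m by (simp add: field_simps)
qed

text \<open>Every point is strictly closer to the centroid of its own half, by the two preceding
  distance formulas.\<close>

lemma dist_centroid_less: "(real m - 1) / real m < 1 + 1 / real m + \<eta>"
proof -
  have "(real m - 1) / real m \<le> 1"
    using m by simp
  then show ?thesis
    using eta by (simp add: add_nonneg_pos order_le_less_trans)
qed

lemma centroids_distinct: "centroid d A \<noteq> centroid d B"
  using A_nonempty dist_centroid_same shifted_simplex.dist_centroid_other[OF swap]
    dist_centroid_less by (metis all_not_in_conv less_irrefl)

lemma card_Un: "card (A \<union> B) = 2 * m"
  using card_Un_disjoint[OF finA finB disj] cardA cardB by simp

section \<open>The optimal cost and the optimal clustering\<close>

lemma center_cost_centroids: "center_cost (A \<union> B) {centroid d A, centroid d B} = 2 * real m - 2"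
proof -
  have "center_cost (A \<union> B) {centroid d A, centroid d B} = (\<Sum>x\<in>A \<union> B. (real m - 1) / real m)"
    unfolding center_cost_def
    using dist_centroid_less dist_centroid_same dist_centroid_other
      shifted_simplex.dist_centroid_same[OF swap] shifted_simplex.dist_centroid_other[OF swap]
    by (intro sum.cong) auto
  also have "\<dots> = 2 * real m * ((real m - 1) / real m)"
    by (simp add: card_Un)
  also have "\<dots> = 2 * real m - 2"
    using m by simp
  finally show ?thesis .
qed

lemma center_cost_ge:
  assumes "center_set d 2 C"
  shows "2 * real m - 2 \<le> center_cost (A \<union> B) C"
proof -
  obtain c c' where C: "C = {c, c'}" and carr: "c \<in> carrier_vec d" "c' \<in> carrier_vec d"
    using assms by (auto simp: center_set_def card_2_iff)
  \<comment> \<open>The points are split by closest center, ties going to \<open>c\<close>. Each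
    side costs at least its size minus 1, and the sizes add up to \<open>2 * m\<close>.\<close>
  define Y where "Y = {x \<in> A \<union> B. sqdist x c \<le> sqdist x c'}"
  define Z where "Z = (A \<union> B) - Y"
  have YZ: "A \<union> B = Y \<union> Z" "Y \<inter> Z = {}" "finite Y" "finite Z"
    using finA finB by (auto simp: Y_def Z_def)
  have "center_cost (A \<union> B) C =
      (\<Sum>x\<in>Y. Min (sqdist x ` C)) + (\<Sum>x\<in>Z. Min (sqdist x ` C))"
    unfolding center_cost_def YZ(1) using YZ by (intro sum.union_disjoint) auto
  also have "(\<Sum>x\<in>Y. Min (sqdist x ` C)) = (\<Sum>x\<in>Y. sqdist x c)"
    by (rule sum.cong) (auto simp: C Y_def)
  also have "(\<Sum>x\<in>Z. Min (sqdist x ` C)) = (\<Sum>x\<in>Z. sqdist x c')"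
    by (rule sum.cong) (auto simp: C Y_def Z_def)
  finally have "real (card Y) - 1 + (real (card Z) - 1) \<le> center_cost (A \<union> B) C"
    using cluster_cost_ge[of Y c] cluster_cost_ge[of Z c'] YZ carr by auto
  moreover have "card Y + card Z = 2 * m"
    using card_Un YZ card_Un_disjoint[of Y Z] by simp
  ultimately show ?thesis by linarith
qed

lemma center_set_centroids: "center_set d 2 {centroid d A, centroid d B}"
  using centroids_distinct by (simp add: center_set_def)

lemma opt_cost: "opt_cost d (A \<union> B) 2 = 2 * real m - 2"
  unfolding opt_cost_def
  by (rule cInf_eq_minimum)
    (use center_set_centroids center_cost_centroids center_cost_ge in \<open>auto simp: image_iff\<close>)

lemma optimal_clustering_unique:
  assumes "optimal_clustering d (A \<union> B) 2 P"
  shows "P = {A, B}"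
proof -
  have part: "partition_on (A \<union> B) P" and "card P = 2"
    and cost: "clustering_cost d P = 2 * real m - 2"
    using assms by (auto simp: optimal_clustering_def opt_cost)
  then obtain Y Z where P: "P = {Y, Z}" and "Y \<noteq> Z"
    by (auto simp: card_2_iff)
  have ne: "Y \<noteq> {}" "Z \<noteq> {}" and un: "Y \<union> Z = A \<union> B" and dj: "Y \<inter> Z = {}"
    using part \<open>Y \<noteq> Z\<close> by (auto simp: P partition_on_def disjoint_def)
  have sub: "Y \<subseteq> A \<union> B" "Z \<subseteq> A \<union> B"
    using un by auto
  have fin: "finite Y" "finite Z"
    using un finA finB by (metis finite_Un)+
  \<comment> \<open>The mixing penalties of the two parts are exactly the excess over the optimum,
    so both vanish and neither part meets both halves.\<close>
  define e where "e W = \<eta> * (real (card (W \<inter> A)) * real (card (W \<inter> B))) / real (card W)" for W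
  have e_nonneg: "0 \<le> e W" for W
    using eta by (simp add: e_def)
  have "real (card Y) - 1 + e Y + (real (card Z) - 1 + e Z) = 2 * real m - 2"
    using cost \<open>Y \<noteq> Z\<close> cluster_cost[OF sub(1) ne(1)] cluster_cost[OF sub(2) ne(2)]
    by (simp add: P clustering_cost_def e_def)
  moreover have "card Y + card Z = 2 * m"
    using card_Un un card_Un_disjoint[OF fin dj] by simp
  ultimately have "e Y = 0" "e Z = 0"
    using e_nonneg[of Y] e_nonneg[of Z] by linarith+
  then have "(Y \<inter> A = {} \<or> Y \<inter> B = {}) \<and> (Z \<inter> A = {} \<or> Z \<inter> B = {})"
    using eta fin ne by (auto simp: e_def)
  moreover have "B \<noteq> {}"
    using cardB m by auto
  ultimately have "Y = A \<and> Z = B \<or> Y = B \<and> Z = A"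
    using un disj dj A_nonempty by blast
  then show ?thesis
    by (auto simp: P)
qed

text \<open>By uniqueness only the clusters \<open>A\<close> and \<open>B\<close> need checking. The
  required bound is \<open>1 - 1 / m\<close>, while a point of the other half is at squared distance
  \<open>1 + 1 / m + \<eta>\<close>.\<close>

lemma distributed_half: "distributed (1/2) d (A \<union> B) 2"
proof -
  have "1 / 2 * ((2 * real m - 2) / real m) \<le> 1 + 1 / real m + \<eta>"
    using m eta by (simp add: field_simps)
  then show ?thesis
    unfolding distributed_def opt_cost
    by (auto dest!: optimal_clustering_unique
        simp: cardA cardB dist_centroid_other shifted_simplex.dist_centroid_other[OF swap])
qed

text \<open>Moving \<open>A\<close> to the centroid of \<open>B\<close> costs
  \<open>m * (1 + 1 / m + \<eta>)\<close>, and the points of \<open>B\<close> still cost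
  \<open>m - 1\<close>; the total is the left side of the assumption.\<close>

lemma not_weakly_deletion_stable:
  assumes "2 * real m + real m * \<eta> \<le> \<beta> * (2 * real m - 2)"
  shows "\<not> weakly_deletion_stable \<beta> d (A \<union> B) 2"
proof -
  define a where "a x = (if x \<in> A then centroid d A else centroid d B)" for x
  have "optimal_centers d (A \<union> B) 2 {centroid d A, centroid d B}"
    using center_set_centroids center_cost_centroids opt_cost by (simp add: optimal_centers_def)
  moreover have "closest_assignment (A \<union> B) {centroid d A, centroid d B} a"
    using disj dist_centroid_less dist_centroid_same dist_centroid_other
      shifted_simplex.dist_centroid_same[OF swap] shifted_simplex.dist_centroid_other[OF swap]
    by (auto simp: closest_assignment_def is_arg_min_def a_def)
  moreover have "deletion_cost (A \<union> B) a (centroid d A) (centroid d B) = 2 * real m + real m * \<eta>"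
  proof -
    have "deletion_cost (A \<union> B) a (centroid d A) (centroid d B) =
        (\<Sum>x\<in>A \<union> B. sqdist x (centroid d B))"
      unfolding deletion_cost_def by (rule sum.cong) (auto simp: a_def)
    also have "\<dots> = (\<Sum>x\<in>A. sqdist x (centroid d B)) + (\<Sum>x\<in>B. sqdist x (centroid d B))"
      by (rule sum.union_disjoint[OF finA finB disj])
    also have "\<dots> = 2 * real m + real m * \<eta>"
      using shifted_simplex.dist_centroid_other[OF swap] shifted_simplex.cost_A[OF swap] cardA m
      by (simp add: algebra_simps)
    finally show ?thesis .
  qed
  ultimately show ?thesis
    using assms centroids_distinct opt_cost unfolding weakly_deletion_stable_def
    by (metis insertCI not_less)
qed

lemma kmeans_instance: "kmeans_instance d (A \<union> B) 2"
  using finA finB carrier card_Un m by (simp add: kmeans_instance_def)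

end

section \<open>Coordinates for the shifted simplex\<close>

text \<open>The simplex consists of standard basis vectors; the additional last coordinate is the
  direction of the shift.\<close>

definition simplex_point :: "nat \<Rightarrow> real \<Rightarrow> nat \<Rightarrow> real vec" where
  "simplex_point m \<delta> i =
     vec (2 * m + 1) (\<lambda>j. if j = 2 * m then if i < m then \<delta> else 0 else if j = i then 1 else 0)"

lemma sqdist_simplex_point:
  assumes "i < 2 * m" "j < 2 * m"
  shows "sqdist (simplex_point m \<delta> i) (simplex_point m \<delta> j) =
    (if i = j then 0 else if i < m \<longleftrightarrow> j < m then 2 else 2 + \<delta>\<^sup>2)"
proof -
  let ?x = "simplex_point m \<delta>"
  have "sqdist (?x i) (?x j) = (\<Sum>l<Suc (2 * m). (?x i $ l - ?x j $ l)\<^sup>2)"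
    by (rule sqdist_sum) (auto simp: simplex_point_def)
  also have "\<dots> = (\<Sum>l<2 * m. (?x i $ l - ?x j $ l)\<^sup>2) + (if i < m \<longleftrightarrow> j < m then 0 else \<delta>\<^sup>2)"
    by (simp add: simplex_point_def)
  also have "(\<Sum>l<2 * m. (?x i $ l - ?x j $ l)\<^sup>2) =
      (\<Sum>l<2 * m. if i = j then 0 else (if l = i then 1 else 0) + (if l = j then 1 else 0))"
    by (rule sum.cong) (auto simp: simplex_point_def)
  also have "\<dots> = (if i = j then 0 else 2)"
    using assms by (simp add: sum.distrib)
  finally show ?thesis by simp
qed

lemma inj_on_simplex_point: "inj_on (simplex_point m \<delta>) {..<2 * m}"
proof (rule inj_onI)
  fix i j assume ij: "i \<in> {..<2 * m}" "j \<in> {..<2 * m}" "simplex_point m \<delta> i = simplex_point m \<delta> j"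
  then have "simplex_point m \<delta> i $ i = simplex_point m \<delta> j $ i"
    by simp
  then show "i = j"
    using ij(1,2) by (simp add: simplex_point_def split: if_splits)
qed

lemma shifted_simplex_simplex_point:
  assumes "2 \<le> m" "\<delta> \<noteq> 0"
  shows "shifted_simplex (2 * m + 1) m (\<delta>\<^sup>2)
    (simplex_point m \<delta> ` {..<m}) (simplex_point m \<delta> ` {m..<2 * m})"
proof -
  let ?x = "simplex_point m \<delta>"
  have inj: "inj_on ?x {..<m}" "inj_on ?x {m..<2 * m}"
    by (rule inj_on_subset[OF inj_on_simplex_point]; force)+
  have eq: "?x i = ?x j \<longleftrightarrow> i = j" if "i < 2 * m" "j < 2 * m" for i j
    using inj_on_simplex_point that by (auto dest: inj_onD)
  \<comment> \<open>Injectivity turns membership in a half into the comparison of indices used by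
    \<open>sqdist_simplex_point\<close>.\<close>
  have mem: "?x i \<in> ?x ` {..<m} \<longleftrightarrow> i < m" if "i < 2 * m" for i
    using that eq by fastforce
  have un: "?x ` {..<m} \<union> ?x ` {m..<2 * m} = ?x ` {..<2 * m}"
    unfolding image_Un[symmetric] by (rule arg_cong[of _ _ "(`) ?x"]) auto
  have carr: "?x i \<in> carrier_vec (2 * m + 1)" for i
    by (simp add: simplex_point_def)
  show ?thesis
  proof
    show "?x ` {..<m} \<inter> ?x ` {m..<2 * m} = {}"
      using eq by (auto simp: image_iff)
    fix x y
    assume "x \<in> ?x ` {..<m} \<union> ?x ` {m..<2 * m}" "y \<in> ?x ` {..<m} \<union> ?x ` {m..<2 * m}"
    then obtain i j where "i < 2 * m" "x = ?x i" "j < 2 * m" "y = ?x j"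
      unfolding un by auto
    then show "sqdist x y = (if x = y then 0
        else if x \<in> ?x ` {..<m} \<longleftrightarrow> y \<in> ?x ` {..<m} then 2 else 2 + \<delta>\<^sup>2)"
      by (simp add: sqdist_simplex_point mem eq)
  qed (use assms inj carr in \<open>auto simp: card_image\<close>)
qed

theorem theorem11:
  shows "\<exists>\<gamma>::real. \<gamma> > 0 \<and>
    (\<forall>\<epsilon>::real. \<epsilon> > 0 \<longrightarrow>
      (\<exists>(d::nat) (X::real vec set) (k::nat).
         kmeans_instance d X k \<and>
         distributed \<gamma> d X k \<and>
         \<not> weakly_deletion_stable (1 + \<epsilon> * \<gamma>) d X k))"
proof (intro exI[of _ "1/2"] conjI allI impI)
  fix \<epsilon> :: real
  assume "\<epsilon> > 0"
  \<comment> \<open>The inequality to reach is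
    \<open>2 + m * \<delta>\<^sup>2 \<le> \<epsilon> * (m - 1)\<close>. The choice of
    \<open>\<delta>\<close> keeps the left side at most 3, and \<open>n\<close> makes the right side
    exceed 3. Only \<open>m\<close> and \<open>\<delta>\<close> depend on \<open>\<epsilon>\<close>;
    the parameter \<open>1/2\<close> stays fixed.\<close>
  obtain n :: nat where n: "3 / \<epsilon> < real n"
    using reals_Archimedean2 by blast
  define m where "m = n + 2"
  define \<delta> where "\<delta> = 1 / real m"
  have "3 < \<epsilon> * (real m - 1)"
    using n \<open>\<epsilon> > 0\<close> by (simp add: m_def field_simps)
  moreover have "real m * \<delta>\<^sup>2 \<le> 1"
    by (simp add: \<delta>_def m_def power2_eq_square)
  ultimately have le: "2 * real m + real m * \<delta>\<^sup>2 \<le> (1 + \<epsilon> * (1/2)) * (2 * real m - 2)"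
    by (simp add: algebra_simps)
  interpret shifted_simplex "2 * m + 1" m "\<delta>\<^sup>2"
      "simplex_point m \<delta> ` {..<m}" "simplex_point m \<delta> ` {m..<2 * m}"
    by (rule shifted_simplex_simplex_point) (simp_all add: m_def \<delta>_def)
  show "\<exists>d X k. kmeans_instance d X k \<and> distributed (1/2) d X k \<and>
      \<not> weakly_deletion_stable (1 + \<epsilon> * (1/2)) d X k"
    using kmeans_instance distributed_half not_weakly_deletion_stable[OF le] by blast
qed simp

end
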